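(* Let $R$ be a ring and let $\Gamma'(R)$ be the unity product graph associated with $R$. Then $\Gamma'(R)$ contains exactly two isolated vertices if $R$ is isomorphic to any of the following: (1) $R\cong\mathbb{Z}_p$, where $p$ is an odd prime; (2) $R\cong\mathbb{F}$, where $\mathbb{F}$ is a field of characteristic $0$.
   Context: $\mathbb{Z}_p$ is the ring of integers modulo $p$. For a ring $R$ with unity $e$, let $U(R)$ denote the set of units of $R$. The unity product graph $\Gamma'(R)$ is the simple graph with vertex set $U(R)$ in which two distinct vertices $r_i,r_j$ are adjacent if and only if $r_i\cdot r_j=e$. A vertex is isolated if no edge is incident to it. *)

theory Defs
  imports
    "HOL-Algebra.QuotRing"
    "HOL-Number_Theory.Residues"
    "Graph_Theory.Pair_Digraph"
begin

definition ring_char :: "('a, 'm) ring_scheme \<Rightarrow> nat" where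
  "ring_char R =
     (if \<exists>n>0. add_pow R (n::nat) \<one>\<^bsub>R\<^esub> = \<zero>\<^bsub>R\<^esub>
      then LEAST n::nat. n > 0 \<and> add_pow R n \<one>\<^bsub>R\<^esub> = \<zero>\<^bsub>R\<^esub>
      else 0)"

text \<open>A simple graph is represented, as in the library, by a symmetric loop-free set of arcs: an
  undirected edge between \<open>u\<close> and \<open>v\<close> is the pair of arcs \<open>(u, v)\<close> and \<open>(v, u)\<close>.
  The library locale \<open>pair_graph\<close> is not used because it requires finitely many vertices.\<close>

definition unity_product_graph :: "('a, 'm) ring_scheme \<Rightarrow> 'a pair_pre_digraph" where
  "unity_product_graph R =
     \<lparr> pverts = Units R,
       parcs = {(r, s). r \<in> Units R \<and> s \<in> Units R \<and> r \<noteq> s \<and> r \<otimes>\<^bsub>R\<^esub> s = \<one>\<^bsub>R\<^esub>} \<rparr>"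

definition isolated_vertices :: "'a pair_pre_digraph \<Rightarrow> 'a set" where
  "isolated_vertices G = {v \<in> pverts G. \<forall>(u, w) \<in> parcs G. u \<noteq> v \<and> w \<noteq> v}"

lemma (in monoid) Units_inverse_commute:
  assumes "r \<in> Units G" "s \<in> Units G" "r \<otimes> s = \<one>"
  shows "s \<otimes> r = \<one>"
proof -
  have "inv r = s"
    using assms inv_unique [of "inv r" r s] by (simp add: Units_closed Units_l_inv)
  then show ?thesis
    using assms(1) Units_l_inv by blast
qed

lemma unity_product_graph_bidirected:
  assumes "ring R"
  shows "pair_bidirected_digraph (unity_product_graph R)"
proof -
  interpret ring R by fact
  let ?G = "unity_product_graph R"
  have "sym (parcs ?G)"
    using Units_inverse_commute by (fastforce simp: unity_product_graph_def intro: symI)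
  then show ?thesis
    by unfold_locales (auto simp: unity_product_graph_def symmetric_def)
qed

end

theory Submission
  imports Defs
begin

text \<open>The only possible neighbour of a unit \<open>v\<close> is its inverse, so \<open>v\<close> is isolated exactly when it is
  its own inverse, that is, when \<open>v\<close> is a square root of \<open>\<one>\<close>. In an integral domain
  \<open>(v \<oplus> \<one>) \<otimes> (v \<ominus> \<one>) = \<zero>\<close> leaves only the square roots \<open>\<one>\<close> and \<open>\<ominus> \<one>\<close>, and these two are distinct as
  soon as \<open>\<one> \<oplus> \<one> \<noteq> \<zero>\<close>. Both families of rings in the theorem consist of fields in which \<open>\<one> \<oplus> \<one> \<noteq> \<zero>\<close>,
  and the properties of being a domain and of having \<open>\<one> \<oplus> \<one> \<noteq> \<zero>\<close> are invariant under ring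
  isomorphism.\<close>

text \<open>A neighbour of a unit \<open>v\<close> can only be \<open>inv v\<close>, and loops are excluded; so \<open>v\<close> is isolated iff
  \<open>inv v = v\<close>. An element squaring to \<open>\<one>\<close> is automatically a unit.\<close>

lemma (in ring) isolated_vertices_unity_product_graph:
  "isolated_vertices (unity_product_graph R) = {v \<in> carrier R. v \<otimes> v = \<one>}"
proof (intro subset_antisym subsetI)
  fix v assume "v \<in> isolated_vertices (unity_product_graph R)"
  then have unit: "v \<in> Units R"
    and isolated: "\<And>w. w \<in> Units R \<Longrightarrow> v \<otimes> w = \<one> \<Longrightarrow> v = w"
    unfolding isolated_vertices_def unity_product_graph_def by auto
  have "v = inv v"
    using unit by (intro isolated Units_inv_Units Units_r_inv)
  then have "v \<otimes> v = \<one>"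
    using Units_r_inv[OF unit] by simp
  with unit show "v \<in> {v \<in> carrier R. v \<otimes> v = \<one>}"
    by (simp add: Units_closed)
next
  fix v assume "v \<in> {v \<in> carrier R. v \<otimes> v = \<one>}"
  then have v: "v \<in> carrier R" "v \<otimes> v = \<one>" and unit: "v \<in> Units R"
    by (auto simp: Units_def)
  have "w = v" if "w \<in> Units R" "v \<otimes> w = \<one>" for w
    using inv_unique[OF v(2) that(2)] that(1) v(1) by (simp add: Units_closed)
  moreover have "w = v" if "w \<in> Units R" "w \<otimes> v = \<one>" for w
    using inv_unique[OF that(2) v(2)] that(1) v(1) by (simp add: Units_closed)
  ultimately show "v \<in> isolated_vertices (unity_product_graph R)"
    using unit unfolding isolated_vertices_def unity_product_graph_def by auto
qed

lemma (in domain) square_roots_of_one: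
  "{v \<in> carrier R. v \<otimes> v = \<one>} = {\<one>, \<ominus> \<one>}"
proof (intro subset_antisym subsetI)
  fix v assume "v \<in> {v \<in> carrier R. v \<otimes> v = \<one>}"
  then have v: "v \<in> carrier R" "v \<otimes> v = \<one>"
    by auto
  have "(v \<oplus> \<one>) \<otimes> (v \<oplus> \<ominus> \<one>) = v \<otimes> v \<oplus> \<ominus> \<one>"
    using v(1) by algebra
  then have "(v \<oplus> \<one>) \<otimes> (v \<oplus> \<ominus> \<one>) = \<zero>"
    using v by (simp add: r_neg)
  then have "v \<oplus> \<one> = \<zero> \<or> v \<oplus> \<ominus> \<one> = \<zero>"
    using v integral by simp
  then show "v \<in> {\<one>, \<ominus> \<one>}"
    using v by (metis add.inv_closed insertCI minus_equality minus_minus one_closed)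
qed (auto simp: l_minus r_minus)

lemma (in domain) card_isolated_vertices_unity_product_graph:
  assumes "\<one> \<oplus> \<one> \<noteq> \<zero>"
  shows "card (isolated_vertices (unity_product_graph R)) = 2"
proof -
  have "\<one> \<noteq> \<ominus> \<one>"
    using assms by (metis one_closed r_neg)
  then show ?thesis
    by (simp add: isolated_vertices_unity_product_graph square_roots_of_one)
qed

lemma domain_ring_iso:
  assumes "ring R" "domain S" "R \<simeq> S"
  shows "domain R"
proof -
  interpret R: ring R by fact
  interpret S: domain S by fact
  from assms(1,3) have "S \<simeq> R"
    by (rule ring_iso_sym)
  then obtain h where h: "h \<in> ring_iso S R"
    by (auto simp: is_ring_iso_def)
  then have "h \<zero>\<^bsub>S\<^esub> = \<zero>\<^bsub>R\<^esub>"
    using ring_hom_zero[of h S R] by (simp add: ring_iso_def R.ring_axioms S.ring_axioms)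
  then show ?thesis
    using S.ring_iso_imp_img_domain[OF h] by simp
qed

text \<open>Only \<open>S\<close> is known to be a well-behaved ring, so its properties are pulled back to \<open>R\<close>. For
  \<open>\<one> \<oplus> \<one> \<noteq> \<zero>\<close> this holds because a unital homomorphism \<open>R \<rightarrow> S\<close> maps the equation \<open>\<one> \<oplus> \<one> = \<zero>\<close>
  in \<open>R\<close> to the same equation in \<open>S\<close>.\<close>

lemma card_isolated_vertices_if_iso_domain:
  assumes "ring R" "domain S" "R \<simeq> S" "\<one>\<^bsub>S\<^esub> \<oplus>\<^bsub>S\<^esub> \<one>\<^bsub>S\<^esub> \<noteq> \<zero>\<^bsub>S\<^esub>"
  shows "card (isolated_vertices (unity_product_graph R)) = 2"
proof -
  interpret R: domain R
    using assms(1-3) by (rule domain_ring_iso)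
  interpret S: domain S by fact
  from assms(3) obtain h where "h \<in> ring_iso R S"
    by (auto simp: is_ring_iso_def)
  then interpret ring_hom_ring R S h
    by (intro ring_hom_ringI2 R.ring_axioms S.ring_axioms) (simp add: ring_iso_def)
  have "h (\<one>\<^bsub>R\<^esub> \<oplus>\<^bsub>R\<^esub> \<one>\<^bsub>R\<^esub>) \<noteq> h \<zero>\<^bsub>R\<^esub>"
    using assms(4) by simp
  then have "\<one>\<^bsub>R\<^esub> \<oplus>\<^bsub>R\<^esub> \<one>\<^bsub>R\<^esub> \<noteq> \<zero>\<^bsub>R\<^esub>"
    by metis
  then show ?thesis
    by (rule R.card_isolated_vertices_unity_product_graph)
qed

lemma (in ring) one_plus_one_neq_zero_if_char_zero:
  assumes "ring_char R = 0"
  shows "\<one> \<oplus> \<one> \<noteq> \<zero>"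
proof
  assume "\<one> \<oplus> \<one> = \<zero>"
  then have "add_pow R (2::nat) \<one> = \<zero>"
    by (simp add: numeral_2_eq_2)
  then have ex: "\<exists>n>0. add_pow R (n::nat) \<one> = \<zero>"
    by (intro exI[of _ 2]) simp
  then have "ring_char R > 0"
    unfolding ring_char_def using LeastI_ex[OF ex] by simp
  with assms show False
    by simp
qed

lemma one_plus_one_neq_zero_residue_ring:
  assumes "m > 2"
  shows "\<one>\<^bsub>residue_ring m\<^esub> \<oplus>\<^bsub>residue_ring m\<^esub> \<one>\<^bsub>residue_ring m\<^esub> \<noteq> \<zero>\<^bsub>residue_ring m\<^esub>"
  using assms by (simp add: residue_ring_def)

theorem theorem3p4:
  fixes R :: "('a, 'm) ring_scheme"
  assumes "ring R"
    and "(\<exists>p::nat. prime p \<and> odd p \<and> R \<simeq> residue_ring (int p)) \<or>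
         (\<exists>F::'b ring. field F \<and> ring_char F = 0 \<and> R \<simeq> F)"
  shows "card (isolated_vertices (unity_product_graph R)) = 2"
  using assms(2)
proof (elim disjE exE conjE)
  fix p :: nat
  assume p: "prime p" "odd p" "R \<simeq> residue_ring (int p)"
  then have "p > 2"
    by (metis even_numeral le_neq_implies_less prime_ge_2_nat)
  interpret residues_prime p "residue_ring (int p)"
    using p(1) by unfold_locales auto
  show ?thesis
    using assms(1) is_field[THEN field.axioms(1)] p(3)
      one_plus_one_neq_zero_residue_ring[of "int p"] \<open>p > 2\<close>
    by (intro card_isolated_vertices_if_iso_domain) auto
next
  fix F :: "'b ring"
  assume F: "field F" "ring_char F = 0" "R \<simeq> F"
  interpret F: field F by fact
  show ?thesis
    using assms(1) F.domain_axioms F(3) F.one_plus_one_neq_zero_if_char_zero[OF F(2)]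
    by (rule card_isolated_vertices_if_iso_domain)
qed

end
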